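(* Let $X\subset\mathbb{R}^n$ be unimodular, let $Z(X)=\{\sum_{x\in X}t_x x:\ t\in[0,1]^X\}$, and denote $\mathcal{Z}_+(X)=Z(X)\cap\mathbb{Z}^n$. Then the restriction map $f\mapsto f|_{\mathcal{Z}_+(X)}$ is a bijection between $\mathcal{P}_+(X)$ and $\mathbb{C}^{\mathcal{Z}_+(X)}$.
   Context: $X$ is a finite multiset of nonzero vectors in $\mathbb{R}^n$ spanning $\mathbb{R}^n$ (repeated vectors are treated as distinct elements). $X$ is unimodular if $X\subset\mathbb{Z}^n$ and every $B\subset X$ that is a basis of $\mathbb{R}^n$ satisfies $\det B=\pm1$. For $y\in\mathbb{R}^n$, $p_y$ is the polynomial $t\mapsto y\cdot t$ in $\mathbb{C}[t_1,\dots,t_n]$; for a multisubset $Y\subset X$, $p_Y=\prod_{y\in Y}p_y$ (with $p_\emptyset=1$); and $\mathcal{P}_+(X)=\mathrm{span}_{\mathbb{C}}\{p_Y:\ Y\subset X\}$. *)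

theory Defs
  imports "HOL-Analysis.Analysis" "HOL-Library.Poly_Mapping"
begin

text \<open>
  A finite multiset of vectors, with repeated vectors regarded as distinct elements, is
  represented by a family \<open>X\<close> of vectors over a finite index set \<open>I\<close>; its submultisets are the
  subsets of \<open>I\<close>.
\<close>

text \<open>
  The ring of complex polynomials in variables indexed by \<open>'n\<close>: finitely supported maps from
  exponent vectors to coefficients, with convolution as multiplication.
\<close>

type_synonym 'n cpoly = "('n \<Rightarrow>\<^sub>0 nat) \<Rightarrow>\<^sub>0 complex"

definition cpoly_const :: "complex \<Rightarrow> 'n cpoly" where
  "cpoly_const c = Poly_Mapping.single 0 c"

definition cpoly_var :: "'n \<Rightarrow> 'n cpoly" where
  "cpoly_var i = Poly_Mapping.single (Poly_Mapping.single i 1) 1"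

definition cpoly_eval :: "'n::finite cpoly \<Rightarrow> complex ^ 'n \<Rightarrow> complex" where
  "cpoly_eval f t =
     (\<Sum>m\<in>Poly_Mapping.keys f. Poly_Mapping.lookup f m * (\<Prod>i\<in>UNIV. (t $ i) ^ Poly_Mapping.lookup m i))"

global_interpretation cpoly: vector_space "\<lambda>c (f :: 'n cpoly). cpoly_const c * f"
  defines cpoly_span = cpoly.span
  by unfold_locales
    (simp_all add: cpoly_const_def algebra_simps single_add single_one mult_single
      flip: mult.assoc)

definition linear_poly :: "real ^ 'n \<Rightarrow> 'n::finite cpoly" where
  "linear_poly y = (\<Sum>i\<in>UNIV. cpoly_const (complex_of_real (y $ i)) * cpoly_var i)"

definition prod_poly :: "('i \<Rightarrow> real ^ 'n) \<Rightarrow> 'i set \<Rightarrow> 'n::finite cpoly" where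
  "prod_poly X Y = (\<Prod>i\<in>Y. linear_poly (X i))"

definition P_plus :: "'i set \<Rightarrow> ('i \<Rightarrow> real ^ 'n) \<Rightarrow> 'n::finite cpoly set" where
  "P_plus I X = cpoly_span (prod_poly X ` Pow I)"

definition integer_points :: "(real ^ 'n) set" where
  "integer_points = {z. \<forall>j. z $ j \<in> \<int>}"

definition basis_family :: "('i \<Rightarrow> real ^ 'n) \<Rightarrow> 'i set \<Rightarrow> bool" where
  "basis_family X B \<longleftrightarrow> inj_on X B \<and> independent (X ` B) \<and> span (X ` B) = UNIV"

text \<open>
  The determinant of a basis is that of the matrix whose columns are its elements, which requires
  an enumeration \<open>e\<close> of the basis by \<open>'n\<close>; up to sign it does not depend on \<open>e\<close>.
\<close>

definition unimodular :: "'i set \<Rightarrow> ('i \<Rightarrow> real ^ 'n) \<Rightarrow> bool" where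
  "unimodular I X \<longleftrightarrow>
     X ` I \<subseteq> integer_points \<and>
     (\<forall>B\<subseteq>I. basis_family X B \<longrightarrow>
        (\<forall>e. bij_betw e (UNIV :: 'n set) B \<longrightarrow> det (\<chi> i j. X (e j) $ i) \<in> {1, -1}))"

definition zonotope :: "'i set \<Rightarrow> ('i \<Rightarrow> real ^ 'n) \<Rightarrow> (real ^ 'n) set" where
  "zonotope I X = {(\<Sum>i\<in>I. t i *\<^sub>R X i) | t. \<forall>i\<in>I. t i \<in> {0..1}}"

definition Z_plus :: "'i set \<Rightarrow> ('i \<Rightarrow> real ^ 'n) \<Rightarrow> (real ^ 'n) set" where
  "Z_plus I X = zonotope I X \<inter> integer_points"

text \<open>
  The function space of complex-valued functions on a set \<open>Z\<close> is \<open>Z \<rightarrow>\<^sub>E UNIV\<close>, whose elements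
  are \<open>undefined\<close> outside \<open>Z\<close>.
\<close>

definition restrict_poly :: "(real ^ 'n) set \<Rightarrow> 'n::finite cpoly \<Rightarrow> real ^ 'n \<Rightarrow> complex" where
  "restrict_poly Z f = (\<lambda>z\<in>Z. cpoly_eval f (\<chi> i. complex_of_real (z $ i)))"

lemma cpoly_eval_superset:
  assumes "finite S" "Poly_Mapping.keys f \<subseteq> S"
  shows "cpoly_eval f t = (\<Sum>m\<in>S. Poly_Mapping.lookup f m * (\<Prod>i\<in>UNIV. (t $ i) ^ Poly_Mapping.lookup m i))"
  unfolding cpoly_eval_def using assms
  by (intro sum.mono_neutral_left) (auto simp: in_keys_iff)

lemma cpoly_eval_add: "cpoly_eval (f + g) t = cpoly_eval f t + cpoly_eval g t"
proof -
  let ?S = "Poly_Mapping.keys f \<union> Poly_Mapping.keys g"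
  have *: "cpoly_eval h t = (\<Sum>m\<in>?S. Poly_Mapping.lookup h m * (\<Prod>i\<in>UNIV. (t $ i) ^ Poly_Mapping.lookup m i))"
    if "Poly_Mapping.keys h \<subseteq> ?S" for h
    using that by (intro cpoly_eval_superset) auto
  have "Poly_Mapping.keys (f + g) \<subseteq> ?S" by (rule Poly_Mapping.keys_add)
  then show ?thesis
    by (simp add: * lookup_add algebra_simps sum.distrib)
qed

lemma cpoly_eval_sum: "cpoly_eval (\<Sum>a\<in>A. F a) t = (\<Sum>a\<in>A. cpoly_eval (F a) t)"
  by (induction A rule: infinite_finite_induct)
    (simp_all add: cpoly_eval_add, simp_all add: cpoly_eval_def)

lemma cpoly_eval_linear_poly:
  "cpoly_eval (linear_poly y) (\<chi> i. complex_of_real (t $ i)) = complex_of_real (y \<bullet> t)"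
proof -
  have *: "(\<Prod>j\<in>UNIV. complex_of_real (t $ j) ^ Poly_Mapping.lookup (Poly_Mapping.single i (1::nat)) j)
      = complex_of_real (t $ i)" for i :: 'a
    by (subst prod.remove[of _ i]) (auto simp: lookup_single when_def intro!: prod.neutral)
  have "cpoly_eval (Poly_Mapping.single (Poly_Mapping.single i 1) c) (\<chi> i. complex_of_real (t $ i))
      = c * complex_of_real (t $ i)" for i c
    unfolding cpoly_eval_def using *[of i] by (auto simp: lookup_single)
  then show ?thesis
    by (simp add: linear_poly_def cpoly_eval_sum cpoly_const_def cpoly_var_def mult_single
        inner_vec_def)
qed

end

theory Submission
  imports Defs "HOL-Library.Function_Algebras"
begin

text \<open>
  Injectivity. Let \<open>f \<noteq> 0\<close> in \<open>P\<^sub>+(X)\<close> have degree \<open>d\<close> and vanish at all subset sums of \<open>X\<close>. For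
  \<open>Y \<subseteq> X\<close> with \<open>|Y| = d\<close>, the iterated difference of \<open>f\<close> along \<open>Y\<close> at \<open>0\<close> only involves values of \<open>f\<close>
  at subset sums, and by polarization it is the inner product of \<open>f\<close> with \<open>p\<^sub>Y\<close> for the (Bombieri)
  form \<open>\<langle>f, g\<rangle> = \<Sum>\<^sub>m m! f\<^sub>m cnj g\<^sub>m\<close>. The top homogeneous part of \<open>f\<close> is a combination of these \<open>p\<^sub>Y\<close>, so
  it has norm \<open>0\<close>, a contradiction.

  Surjectivity. It remains to find as many linearly independent \<open>p\<^sub>Y\<close> as there are lattice points in
  the zonotope, by deletion and contraction of \<open>x \<in> X\<close>. On each line parallel to \<open>x\<close>, all lattice points
  of \<open>Z(X)\<close> but the last one lie in \<open>Z(X - x)\<close>, and the last ones inject into the lattice points of the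
  projection of \<open>Z(X)\<close> to the orthogonal complement of \<open>x\<close>. On the polynomial side, multiplication by
  \<open>p\<^sub>x\<close> embeds \<open>P\<^sub>+(X - x)\<close> into the kernel of the restriction to that complement, whose image is the
  space of the projected family.
\<close>

subsection \<open>Polarization\<close>

lemma inj_on_insert_Pow:
  assumes "x \<notin> J"
  shows "inj_on (insert x) (Pow J)"
  using assms by (auto simp: inj_on_def)

lemma sum_Pow_insert:
  fixes g :: "'i set \<Rightarrow> 'b::comm_monoid_add"
  assumes "finite Y" "x \<notin> Y"
  shows "(\<Sum>T\<in>Pow (insert x Y). g T) = (\<Sum>T\<in>Pow Y. g T) + (\<Sum>T\<in>Pow Y. g (insert x T))"
proof -
  have "Pow Y \<inter> insert x ` Pow Y = {}"
    using assms(2) by auto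
  then show ?thesis
    using assms by (simp add: Pow_insert sum.union_disjoint sum.reindex inj_on_insert_Pow)
qed

text \<open>This is the iterated difference of \<open>u ^ k\<close> at \<open>b\<close> in the
  directions \<open>a i\<close>. Each difference lowers the degree in \<open>u\<close>, so
  \<open>card Y\<close> of them kill every smaller power and leave only a constant from the top
  one.\<close>

lemma polarization_shifted:
  fixes a :: "'i \<Rightarrow> 'r::comm_ring_1"
  assumes "finite Y" "k \<le> card Y"
  shows "(\<Sum>T\<in>Pow Y. (-1) ^ card (Y - T) * (b + sum a T) ^ k) =
           (if k = card Y then of_nat (fact k) * prod a Y else 0)"
  using assms
proof (induction Y arbitrary: k rule: finite_induct)
  case empty
  then show ?case by simp
next
  case (insert x Y)
  define c where "c k j = of_nat (k choose j) * a x ^ (k - j)" for k j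
  have step: "(b + (a x + s)) ^ k = (b + s) ^ k + (\<Sum>j<k. c k j * (b + s) ^ j)" for s
  proof -
    have "(b + (a x + s)) ^ k = ((b + s) + a x) ^ k"
      by (simp add: algebra_simps)
    also have "\<dots> = (\<Sum>j\<le>k. c k j * (b + s) ^ j)"
      unfolding binomial_ring c_def by (simp add: mult_ac)
    also have "\<dots> = (\<Sum>j<k. c k j * (b + s) ^ j) + c k k * (b + s) ^ k"
      by (simp add: lessThan_Suc_atMost[symmetric])
    finally show ?thesis by (simp add: c_def)
  qed
  have "(\<Sum>T\<in>Pow (insert x Y). (-1) ^ card (insert x Y - T) * (b + sum a T) ^ k)
      = (\<Sum>T\<in>Pow Y. (-1) ^ card (insert x Y - T) * (b + sum a T) ^ k)
        + (\<Sum>T\<in>Pow Y. (-1) ^ card (insert x Y - insert x T) * (b + sum a (insert x T)) ^ k)"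
    using insert.hyps by (rule sum_Pow_insert)
  also have "(\<Sum>T\<in>Pow Y. (-1) ^ card (insert x Y - T) * (b + sum a T) ^ k)
      = (\<Sum>T\<in>Pow Y. - ((-1) ^ card (Y - T) * (b + sum a T) ^ k))"
  proof (rule sum.cong[OF refl])
    fix T assume "T \<in> Pow Y"
    then have "insert x Y - T = insert x (Y - T)" "x \<notin> Y - T" "finite (Y - T)"
      using insert.hyps by auto
    then show "(-1) ^ card (insert x Y - T) * (b + sum a T) ^ k = - ((-1) ^ card (Y - T) * (b + sum a T) ^ k)"
      by simp
  qed
  also have "(\<Sum>T\<in>Pow Y. (-1) ^ card (insert x Y - insert x T) * (b + sum a (insert x T)) ^ k)
      = (\<Sum>T\<in>Pow Y. (-1) ^ card (Y - T) * (b + sum a T) ^ k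
           + (\<Sum>j<k. c k j * ((-1) ^ card (Y - T) * (b + sum a T) ^ j)))"
  proof (rule sum.cong[OF refl])
    fix T assume T: "T \<in> Pow Y"
    then have "insert x Y - insert x T = Y - T" "x \<notin> T" "finite T"
      using insert.hyps finite_subset by auto
    then show "(-1) ^ card (insert x Y - insert x T) * (b + sum a (insert x T)) ^ k =
        (-1) ^ card (Y - T) * (b + sum a T) ^ k
           + (\<Sum>j<k. c k j * ((-1) ^ card (Y - T) * (b + sum a T) ^ j))"
      by (simp add: step distrib_left sum_distrib_left mult_ac)
  qed
  also have "(\<Sum>T\<in>Pow Y. - ((-1) ^ card (Y - T) * (b + sum a T) ^ k)) + \<dots>
      = (\<Sum>j<k. c k j * (\<Sum>T\<in>Pow Y. (-1) ^ card (Y - T) * (b + sum a T) ^ j))"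
    by (simp add: sum.distrib sum_negf sum_distrib_left sum.swap[of _ "Pow Y"])
  \<comment> \<open>Here \<open>j < k \<le> Suc (card Y)\<close>, so the induction hypothesis covers
    every \<open>j\<close>. Only \<open>j = card Y\<close> can survive, and then
    \<open>c k j = k * a x\<close>.\<close>
  also have "\<dots> = (\<Sum>j<k. c k j * (if j = card Y then of_nat (fact j) * prod a Y else 0))"
    using insert by (intro sum.cong refl arg_cong2[where f="(*)"] insert.IH) auto
  also have "\<dots> = (if k = card (insert x Y) then of_nat (fact k) * prod a (insert x Y) else 0)"
  proof (cases "k = Suc (card Y)")
    case True
    then have "(\<Sum>j<k. c k j * (if j = card Y then of_nat (fact j) * prod a Y else 0))
        = c k (card Y) * (of_nat (fact (card Y)) * prod a Y)"
      by (simp add: if_distrib cong: if_cong)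
    then show ?thesis
      using True insert.hyps by (simp add: c_def algebra_simps)
  next
    case False
    then have "k \<le> card Y" using insert by auto
    then show ?thesis using insert.hyps by (auto intro!: sum.neutral)
  qed
  finally show ?case .
qed

lemma polarization:
  fixes a :: "'i \<Rightarrow> 'r::comm_ring_1"
  assumes "finite Y" "k \<le> card Y"
  shows "(\<Sum>T\<in>Pow Y. (-1) ^ card (Y - T) * sum a T ^ k) =
           (if k = card Y then of_nat (fact k) * prod a Y else 0)"
  using polarization_shifted[OF assms, of 0 a] by simp

subsection \<open>Evaluation and coefficients\<close>

definition monomial_at :: "complex ^ 'n \<Rightarrow> ('n::finite \<Rightarrow>\<^sub>0 nat) \<Rightarrow> complex" where
  "monomial_at t m = (\<Prod>i\<in>UNIV. (t $ i) ^ Poly_Mapping.lookup m i)"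

definition exponent_degree :: "('n::finite \<Rightarrow>\<^sub>0 nat) \<Rightarrow> nat" where
  "exponent_degree m = (\<Sum>i\<in>UNIV. Poly_Mapping.lookup m i)"

definition exponent_fact :: "('n::finite \<Rightarrow>\<^sub>0 nat) \<Rightarrow> complex" where
  "exponent_fact m = (\<Prod>i\<in>UNIV. fact (Poly_Mapping.lookup m i))"

definition complex_vec :: "real ^ 'n \<Rightarrow> complex ^ 'n" where
  "complex_vec z = (\<chi> i. complex_of_real (z $ i))"

lemma exponent_fact_nonzero [simp]: "exponent_fact m \<noteq> 0"
  by (simp add: exponent_fact_def)

text \<open>Positivity of the weights \<open>m!\<close> makes the Bombieri form definite.\<close>

lemma exponent_fact_eq_of_real: "\<exists>r>0. exponent_fact m = complex_of_real r"
  by (intro exI[of _ "\<Prod>i\<in>UNIV. fact (Poly_Mapping.lookup m i)"])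
    (simp add: exponent_fact_def prod_pos)

lemma monomial_at_0 [simp]: "monomial_at t 0 = 1"
  by (simp add: monomial_at_def)

lemma monomial_at_add: "monomial_at t (m + n) = monomial_at t m * monomial_at t n"
  by (simp add: monomial_at_def lookup_add power_add prod.distrib)

lemma monomial_at_single: "monomial_at t (Poly_Mapping.single i 1) = t $ i"
proof -
  have "monomial_at t (Poly_Mapping.single i 1) = (\<Prod>j\<in>UNIV. if j = i then t $ i else 1)"
    unfolding monomial_at_def by (intro prod.cong refl) (auto simp: lookup_single when_def)
  then show ?thesis by simp
qed

lemma cnj_monomial_at_complex_vec: "cnj (monomial_at (complex_vec z) m) = monomial_at (complex_vec z) m"
  by (simp add: monomial_at_def complex_vec_def)

lemma exponent_degree_single_add: "exponent_degree (Poly_Mapping.single i 1 + n) = Suc (exponent_degree n)"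
proof -
  have "(\<Sum>j\<in>UNIV. Poly_Mapping.lookup (Poly_Mapping.single i (1::nat)) j) = (\<Sum>j\<in>UNIV. if j = i then 1 else 0)"
    by (intro sum.cong refl) (auto simp: lookup_single when_def)
  then show ?thesis by (simp add: exponent_degree_def lookup_add sum.distrib)
qed

lemma exponent_fact_single_add:
  "exponent_fact (Poly_Mapping.single i 1 + n) = of_nat (Suc (Poly_Mapping.lookup n i)) * exponent_fact n"
proof -
  have "(\<Prod>j\<in>UNIV - {i}. fact (Poly_Mapping.lookup (Poly_Mapping.single i 1 + n) j) :: complex)
      = (\<Prod>j\<in>UNIV - {i}. fact (Poly_Mapping.lookup n j))"
    by (intro prod.cong refl) (auto simp: lookup_add lookup_single when_def)
  then show ?thesis
    unfolding exponent_fact_def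
    by (subst (1 2) prod.remove[of _ i]) (auto simp: lookup_add lookup_single algebra_simps)
qed

lemma poly_mapping_sum_singles:
  "f = (\<Sum>m\<in>Poly_Mapping.keys f. Poly_Mapping.single m (Poly_Mapping.lookup f m))"
proof (rule poly_mapping_eqI)
  fix k
  show "Poly_Mapping.lookup f k = Poly_Mapping.lookup (\<Sum>m\<in>Poly_Mapping.keys f. Poly_Mapping.single m (Poly_Mapping.lookup f m)) k"
    by (cases "k \<in> Poly_Mapping.keys f") (auto simp: lookup_sum lookup_single when_def in_keys_iff)
qed

lemma cpoly_eval_single: "cpoly_eval (Poly_Mapping.single m c) t = c * monomial_at t m"
  by (subst cpoly_eval_superset[of "{m}"]) (auto simp: monomial_at_def)

lemma cpoly_eval_mult: "cpoly_eval (f * g) t = cpoly_eval f t * cpoly_eval g t"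
proof -
  let ?s = "\<lambda>f m. Poly_Mapping.single m (Poly_Mapping.lookup f m)"
  let ?F = "Poly_Mapping.keys f" and ?G = "Poly_Mapping.keys g"
  have "f * g = (\<Sum>m\<in>?F. ?s f m) * (\<Sum>n\<in>?G. ?s g n)"
    by (simp flip: poly_mapping_sum_singles)
  then have "cpoly_eval (f * g) t = (\<Sum>m\<in>?F. \<Sum>n\<in>?G. cpoly_eval (?s f m * ?s g n) t)"
    by (simp add: sum_product cpoly_eval_sum)
  also have "\<dots> = (\<Sum>m\<in>?F. \<Sum>n\<in>?G. cpoly_eval (?s f m) t * cpoly_eval (?s g n) t)"
    by (simp add: mult_single cpoly_eval_single monomial_at_add mult_ac)
  also have "\<dots> = cpoly_eval (\<Sum>m\<in>?F. ?s f m) t * cpoly_eval (\<Sum>n\<in>?G. ?s g n) t"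
    by (simp add: sum_product cpoly_eval_sum)
  finally show ?thesis by (simp flip: poly_mapping_sum_singles)
qed

lemma cpoly_eval_const: "cpoly_eval (cpoly_const c) t = c"
  by (simp add: cpoly_const_def cpoly_eval_single)

lemma cpoly_eval_prod_poly:
  "cpoly_eval (prod_poly X Y) (complex_vec t) = (\<Prod>i\<in>Y. complex_of_real (X i \<bullet> t))"
proof (induction Y rule: infinite_finite_induct)
  case (insert x Y)
  then show ?case
    by (simp add: prod_poly_def cpoly_eval_mult complex_vec_def cpoly_eval_linear_poly)
qed (use cpoly_eval_const[of 1 "complex_vec t"] in
      \<open>simp_all add: prod_poly_def cpoly_const_def single_one\<close>)

lemma lookup_cpoly_const_mult: "Poly_Mapping.lookup (cpoly_const c * f) m = c * Poly_Mapping.lookup f m"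
  unfolding cpoly_const_def mult_map_scale_conv_mult[symmetric]
  by (simp add: Poly_Mapping.map.rep_eq when_def)

lemma lookup_cpoly_var_mult:
  "Poly_Mapping.lookup (cpoly_var i * f) (Poly_Mapping.single i 1 + n) = Poly_Mapping.lookup f n"
proof -
  have "cpoly_var i * f = (\<Sum>m\<in>Poly_Mapping.keys f. Poly_Mapping.single (Poly_Mapping.single i 1 + m) (Poly_Mapping.lookup f m))"
    by (subst (1) poly_mapping_sum_singles[of f])
      (simp add: cpoly_var_def sum_distrib_left mult_single)
  then show ?thesis
    by (cases "n \<in> Poly_Mapping.keys f") (auto simp: lookup_sum lookup_single when_def in_keys_iff)
qed

lemma lookup_cpoly_var_mult_eq_0:
  assumes "Poly_Mapping.lookup m i = 0"
  shows "Poly_Mapping.lookup (cpoly_var i * f) m = 0"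
proof (rule ccontr)
  assume "Poly_Mapping.lookup (cpoly_var i * f) m \<noteq> 0"
  then have "m \<in> Poly_Mapping.keys (cpoly_var i * f)"
    by (simp add: in_keys_iff)
  then obtain a b where "a \<in> Poly_Mapping.keys (cpoly_var i)" "m = a + b"
    using keys_mult by blast
  then have "m = Poly_Mapping.single i 1 + b"
    by (auto simp: cpoly_var_def split: if_splits)
  then show False using assms by (simp add: lookup_add)
qed

text \<open>The multinomial theorem: \<open>p\<^sub>z\<^sup>k = \<Sum>\<^bsub>|m| = k\<^esub> (k! / m!) z\<^sup>m t\<^sup>m\<close>.\<close>

lemma lookup_linear_poly_power:
  "exponent_fact m * Poly_Mapping.lookup (linear_poly z ^ k) m =
     (if exponent_degree m = k then fact k * monomial_at (complex_vec z) m else 0)"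
proof (induction k arbitrary: m)
  case 0
  have "exponent_degree m = 0 \<longleftrightarrow> m = 0"
    by (auto simp: exponent_degree_def intro!: poly_mapping_eqI)
  then show ?case
    by (auto simp: lookup_one when_def exponent_fact_def)
next
  case (Suc k)
  let ?z = "complex_vec z"
  \<comment> \<open>Multiplication by \<open>z_i t_i\<close> shifts exponents by \<open>e_i\<close>,
    and \<open>m! = m_i (m - e_i)!\<close>. Summed over \<open>i\<close>, the factors
    \<open>m_i\<close> give the degree \<open>Suc k\<close>, which completes the factorial.\<close>
  have summand: "exponent_fact m * (?z $ i * Poly_Mapping.lookup (cpoly_var i * linear_poly z ^ k) m)
      = (if exponent_degree m = Suc k then of_nat (Poly_Mapping.lookup m i) * fact k * monomial_at ?z m else 0)" for i
  proof (cases "Poly_Mapping.lookup m i")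
    case 0
    then show ?thesis by (simp add: lookup_cpoly_var_mult_eq_0)
  next
    case (Suc r)
    define n where "n = m - Poly_Mapping.single i 1"
    have m: "m = Poly_Mapping.single i 1 + n"
      using Suc by (intro poly_mapping_eqI) (auto simp: n_def lookup_add lookup_minus lookup_single when_def)
    have "Poly_Mapping.lookup n i = r" using Suc by (simp add: m lookup_add)
    then have "exponent_fact m * (?z $ i * Poly_Mapping.lookup (cpoly_var i * linear_poly z ^ k) m)
        = of_nat (Suc r) * ?z $ i * (exponent_fact n * Poly_Mapping.lookup (linear_poly z ^ k) n)"
      unfolding m exponent_fact_single_add lookup_cpoly_var_mult by (simp add: mult_ac)
    also have "\<dots> = (if exponent_degree m = Suc k then of_nat (Suc r) * fact k * monomial_at ?z m else 0)"
      unfolding Suc.IH m exponent_degree_single_add monomial_at_add monomial_at_single by simp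
    finally show ?thesis using Suc by simp
  qed
  have "Poly_Mapping.lookup (linear_poly z ^ Suc k) m
      = (\<Sum>i\<in>UNIV. ?z $ i * Poly_Mapping.lookup (cpoly_var i * linear_poly z ^ k) m)"
    by (simp add: linear_poly_def sum_distrib_right lookup_sum lookup_cpoly_const_mult mult.assoc
        complex_vec_def)
  then have "exponent_fact m * Poly_Mapping.lookup (linear_poly z ^ Suc k) m
      = (if exponent_degree m = Suc k then (\<Sum>i\<in>UNIV. of_nat (Poly_Mapping.lookup m i) * fact k * monomial_at ?z m) else 0)"
    by (simp only: sum_distrib_left summand) simp
  also have "(\<Sum>i\<in>UNIV. of_nat (Poly_Mapping.lookup m i) * fact k * monomial_at ?z m)
      = of_nat (exponent_degree m) * fact k * monomial_at ?z m"
    by (simp add: exponent_degree_def sum_distrib_right)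
  finally show ?case by simp
qed

section \<open>Coefficients of products of linear forms\<close>

lemma linear_poly_add: "linear_poly (y + z) = linear_poly y + linear_poly z"
  by (simp add: linear_poly_def cpoly_const_def single_add distrib_right sum.distrib)

lemma linear_poly_sum: "linear_poly (sum X T) = (\<Sum>i\<in>T. linear_poly (X i))"
proof (induction T rule: infinite_finite_induct)
  case (insert x T)
  then show ?case by (simp add: linear_poly_add)
qed (simp_all add: linear_poly_def cpoly_const_def)

lemma lookup_signed_mult:
  "Poly_Mapping.lookup ((-1) ^ k * (f :: 'n cpoly)) m = (-1) ^ k * Poly_Mapping.lookup f m"
  by (cases "even k") simp_all

lemma lookup_of_nat_mult:
  "Poly_Mapping.lookup (of_nat k * (f :: 'n cpoly)) m = of_nat k * Poly_Mapping.lookup f m"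
  using lookup_cpoly_const_mult[of "of_nat k" f m] by (simp add: cpoly_const_def)

text \<open>Polarization is applied in the polynomial ring itself, with
  \<open>linear_poly (X i)\<close> as \<open>a i\<close>. At the exponent \<open>m\<close>, the
  multinomial formula turns powers of linear forms into monomials evaluated at subset sums.\<close>

lemma lookup_prod_poly_polarized:
  assumes "finite Y" "k \<le> card Y"
  shows "(if k = card Y then of_nat (fact k) * (exponent_fact m * Poly_Mapping.lookup (prod_poly X Y) m) else 0) =
    (if exponent_degree m = k
     then fact k * (\<Sum>T\<in>Pow Y. (-1) ^ card (Y - T) * monomial_at (complex_vec (sum X T)) m) else 0)"
proof -
  have "(\<Sum>T\<in>Pow Y. (-1) ^ card (Y - T) * linear_poly (sum X T) ^ k) =
        (if k = card Y then of_nat (fact k) * prod_poly X Y else 0)"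
    unfolding linear_poly_sum prod_poly_def by (rule polarization[OF assms])
  from arg_cong[OF this, of "\<lambda>f. exponent_fact m * Poly_Mapping.lookup f m"]
  have "(\<Sum>T\<in>Pow Y. (-1) ^ card (Y - T) * (exponent_fact m * Poly_Mapping.lookup (linear_poly (sum X T) ^ k) m)) =
        (if k = card Y then of_nat (fact k) * (exponent_fact m * Poly_Mapping.lookup (prod_poly X Y) m) else 0)"
    by (simp add: lookup_sum lookup_signed_mult lookup_of_nat_mult sum_distrib_left
        mult.left_commute[of "exponent_fact m"] split: if_splits del: of_nat_fact)
  then show ?thesis
    unfolding lookup_linear_poly_power
    by (cases "exponent_degree m = k") (simp_all add: sum_distrib_left mult.left_commute)
qed

lemma lookup_prod_poly_eq_0:
  assumes "finite Y" "exponent_degree m \<noteq> card Y"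
  shows "Poly_Mapping.lookup (prod_poly X Y) m = 0"
  using lookup_prod_poly_polarized[OF assms(1) order_refl, of m X] assms(2) by simp

text \<open>The bridge from values to coefficients: an iterated difference of a monomial at 0
  becomes its Bombieri pairing with \<open>p_Y\<close>. The polarized formula is used at
  \<open>k = exponent_degree m\<close>; below degree \<open>card Y\<close> both sides are 0.\<close>

lemma signed_sum_monomial_at:
  assumes "finite Y" "exponent_degree m \<le> card Y"
  shows "(\<Sum>T\<in>Pow Y. (-1) ^ card (Y - T) * monomial_at (complex_vec (sum X T)) m) =
    exponent_fact m * Poly_Mapping.lookup (prod_poly X Y) m"
  using lookup_prod_poly_polarized[OF assms, of m X] lookup_prod_poly_eq_0[OF assms(1), of m X]
  by (cases "exponent_degree m = card Y") simp_all

text \<open>Up to the positive real factor \<open>m!\<close>, the coefficient is a signed sum of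
  monomials at real points.\<close>

lemma cnj_lookup_prod_poly:
  assumes "finite Y"
  shows "cnj (Poly_Mapping.lookup (prod_poly X Y) m) = Poly_Mapping.lookup (prod_poly X Y) m"
proof (cases "exponent_degree m = card Y")
  case True
  let ?s = "\<Sum>T\<in>Pow Y. (-1) ^ card (Y - T) * monomial_at (complex_vec (sum X T)) m"
  obtain r where r: "r > 0" "exponent_fact m = complex_of_real r"
    using exponent_fact_eq_of_real by blast
  have "?s = complex_of_real r * Poly_Mapping.lookup (prod_poly X Y) m"
    using signed_sum_monomial_at[OF assms, of m X] True r by simp
  moreover have "cnj ?s = ?s"
    by (simp add: cnj_monomial_at_complex_vec)
  ultimately show ?thesis using r(1) by auto
qed (simp add: lookup_prod_poly_eq_0[OF assms])

subsection \<open>Injectivity\<close>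

text \<open>Coefficients are indexed by subsets rather than by polynomials, so that different
  \<open>Y\<close> may give the same product.\<close>

lemma P_plus_eq:
  assumes "finite I"
  shows "P_plus I X = range (\<lambda>c. \<Sum>Y\<in>Pow I. cpoly_const (c Y) * prod_poly X Y)"
proof
  let ?g = "\<lambda>c. \<Sum>Y\<in>Pow I. cpoly_const (c Y) * prod_poly X Y"
  show "range ?g \<subseteq> P_plus I X"
    unfolding P_plus_def
    by (intro image_subsetI cpoly.span_sum cpoly.span_scale cpoly.span_base imageI)
  have "cpoly.subspace (range ?g)"
  proof (rule cpoly.subspaceI)
    show "0 \<in> range ?g"
      by (intro range_eqI[of _ _ "\<lambda>_. 0"]) (simp add: cpoly_const_def)
  next
    fix f g assume "f \<in> range ?g" "g \<in> range ?g"
    then obtain c d where "f = ?g c" "g = ?g d" by auto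
    then show "f + g \<in> range ?g"
      by (intro range_eqI[of _ _ "\<lambda>Y. c Y + d Y"])
        (simp add: cpoly_const_def single_add distrib_right sum.distrib)
  next
    fix a f assume "f \<in> range ?g"
    then obtain c where "f = ?g c" by auto
    then show "cpoly_const a * f \<in> range ?g"
      by (intro range_eqI[of _ _ "\<lambda>Y. a * c Y"])
        (simp add: cpoly_const_def sum_distrib_left mult_single flip: mult.assoc)
  qed
  moreover have "prod_poly X ` Pow I \<subseteq> range ?g"
  proof
    fix f assume "f \<in> prod_poly X ` Pow I"
    then obtain Y where Y: "Y \<in> Pow I" "f = prod_poly X Y" by auto
    have "?g (\<lambda>Z. if Z = Y then 1 else 0) = (\<Sum>Z\<in>Pow I. if Z = Y then prod_poly X Z else 0)"
      by (intro sum.cong refl) (simp add: cpoly_const_def)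
    also have "\<dots> = f" using Y assms by simp
    finally show "f \<in> range ?g" by (intro range_eqI) (rule sym)
  qed
  ultimately show "P_plus I X \<subseteq> range ?g"
    unfolding P_plus_def by (intro cpoly.span_minimal)
qed

lemma P_plus_eq_0_if_vanishes_on_subset_sums:
  assumes "finite I" "f \<in> P_plus I X"
    and vanish: "\<And>T. T \<subseteq> I \<Longrightarrow> cpoly_eval f (complex_vec (sum X T)) = 0"
  shows "f = 0"
proof (rule ccontr)
  assume "f \<noteq> 0"
  let ?l = Poly_Mapping.lookup and ?K = "Poly_Mapping.keys f"
  have K: "finite ?K" "?K \<noteq> {}" using \<open>f \<noteq> 0\<close> by auto
  define d where "d = Max (exponent_degree ` ?K)"
  have deg: "exponent_degree m \<le> d" if "m \<in> ?K" for m
    using that K by (simp add: d_def)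
  have "d \<in> exponent_degree ` ?K"
    unfolding d_def using K by (intro Max_in) auto
  then obtain m0 where m0: "m0 \<in> ?K" "exponent_degree m0 = d" by auto
  obtain c where f: "f = (\<Sum>Y\<in>Pow I. cpoly_const (c Y) * prod_poly X Y)"
    using assms(1,2) by (auto simp: P_plus_eq)
  define D where "D = {Y. Y \<subseteq> I \<and> card Y = d}"
  have D: "finite D" "D \<subseteq> Pow I" using assms(1) by (auto simp: D_def)
  have finY: "finite Y" if "Y \<in> Pow I" for Y using that assms(1) finite_subset by auto

  \<comment> \<open>Every exponent in \<open>f\<close> has degree at most \<open>d = card Y\<close>,
    so \<open>signed_sum_monomial_at\<close> applies to each monomial in the difference of
    \<open>f\<close>.\<close>
  have orthogonal: "(\<Sum>m\<in>?K. exponent_fact m * ?l f m * ?l (prod_poly X Y) m) = 0" if "Y \<in> D" for Y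
  proof -
    have Y: "Y \<subseteq> I" "card Y = d" "finite Y" using that finY by (auto simp: D_def)
    have "0 = (\<Sum>T\<in>Pow Y. (-1) ^ card (Y - T) * cpoly_eval f (complex_vec (sum X T)))"
      using Y(1) by (intro sum.neutral[symmetric]) (auto simp: vanish)
    also have "\<dots> = (\<Sum>m\<in>?K. ?l f m * (\<Sum>T\<in>Pow Y. (-1) ^ card (Y - T) * monomial_at (complex_vec (sum X T)) m))"
      unfolding cpoly_eval_def monomial_at_def[symmetric]
      by (simp add: sum_distrib_left mult_ac sum.swap[of _ "Pow Y"])
    also have "\<dots> = (\<Sum>m\<in>?K. ?l f m * (exponent_fact m * ?l (prod_poly X Y) m))"
      using Y deg by (intro sum.cong refl) (simp add: signed_sum_monomial_at)
    finally show ?thesis by (simp add: mult_ac)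
  qed
  \<comment> \<open>By homogeneity, only the \<open>Y\<close> with \<open>card Y = d\<close>
    contribute to degree \<open>d\<close>, and they contribute to no other degree.\<close>
  have top: "(\<Sum>Y\<in>D. c Y * ?l (prod_poly X Y) m) = (if exponent_degree m = d then ?l f m else 0)" for m
  proof (cases "exponent_degree m = d")
    case True
    have "(\<Sum>Y\<in>D. c Y * ?l (prod_poly X Y) m) = (\<Sum>Y\<in>Pow I. c Y * ?l (prod_poly X Y) m)"
    proof (rule sum.mono_neutral_left)
      show "\<forall>Y\<in>Pow I - D. c Y * ?l (prod_poly X Y) m = 0"
        using True finY lookup_prod_poly_eq_0[of _ m X] by (fastforce simp: D_def)
    qed (use assms(1) D in auto)
    then show ?thesis
      using True by (simp add: f lookup_sum lookup_cpoly_const_mult)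
  next
    case False
    then show ?thesis
      using finY by (auto simp: D_def lookup_prod_poly_eq_0 intro!: sum.neutral)
  qed
  define r where "r m = (SOME r. r > 0 \<and> exponent_fact m = complex_of_real r)" for m :: "'b \<Rightarrow>\<^sub>0 nat"
  have r: "r m > 0 \<and> exponent_fact m = complex_of_real (r m)" for m
    unfolding r_def by (rule someI_ex) (use exponent_fact_eq_of_real in blast)
  let ?N = "\<lambda>m. if exponent_degree m = d then r m * (cmod (?l f m))\<^sup>2 else 0"
  \<comment> \<open>Weighting the orthogonality relations by \<open>cnj (c Y)\<close> reassembles
    the conjugate of the top part of \<open>f\<close>, so its squared Bombieri norm is 0.\<close>
  have "0 = (\<Sum>Y\<in>D. cnj (c Y) * (\<Sum>m\<in>?K. exponent_fact m * ?l f m * ?l (prod_poly X Y) m))"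
    by (intro sum.neutral[symmetric]) (simp add: orthogonal)
  also have "\<dots> = (\<Sum>m\<in>?K. \<Sum>Y\<in>D. exponent_fact m * ?l f m * (cnj (c Y) * ?l (prod_poly X Y) m))"
    by (simp add: sum_distrib_left mult_ac sum.swap[of _ D])
  also have "\<dots> = (\<Sum>m\<in>?K. exponent_fact m * ?l f m * cnj (\<Sum>Y\<in>D. c Y * ?l (prod_poly X Y) m))"
    using D finY by (auto simp: sum_distrib_left cnj_lookup_prod_poly subset_iff intro!: sum.cong)
  also have "\<dots> = (\<Sum>m\<in>?K. complex_of_real (?N m))"
  proof (intro sum.cong refl)
    fix m
    show "exponent_fact m * ?l f m * cnj (\<Sum>Y\<in>D. c Y * ?l (prod_poly X Y) m) = complex_of_real (?N m)"
      using r[of m] unfolding top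
      by (cases "exponent_degree m = d") (simp_all only: of_real_mult complex_norm_square mult.assoc
          refl if_True if_False complex_cnj_zero of_real_0 mult_zero_right)
  qed
  also have "\<dots> = complex_of_real (\<Sum>m\<in>?K. ?N m)" by simp
  finally have "complex_of_real (\<Sum>m\<in>?K. ?N m) = 0"
    by (rule sym)
  then have "(\<Sum>m\<in>?K. ?N m) = 0"
    by (simp only: of_real_eq_0_iff)
  moreover have "?N m \<ge> 0" for m using r[of m] by simp
  ultimately have "?N m0 = 0"
    using K(1) m0(1) by (subst (asm) sum_nonneg_eq_0_iff) auto
  then have "?l f m0 = 0" using m0(2) r[of m0] by simp
  then show False using m0(1) by (simp add: in_keys_iff)
qed

subsection \<open>Deletion and contraction\<close>

text \<open>Independence of the family, not of its image: a repeated vector makes it fail.\<close>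

definition independent_family :: "('i \<Rightarrow> 'v::real_vector) \<Rightarrow> 'i set \<Rightarrow> bool" where
  "independent_family X B \<longleftrightarrow> (\<forall>c. (\<Sum>i\<in>B. c i *\<^sub>R X i) = 0 \<longrightarrow> (\<forall>i\<in>B. c i = 0))"

text \<open>Unimodularity relative to a lattice \<open>L\<close>, in a form that is inherited by contractions.\<close>

definition integral_coordinates :: "'v set \<Rightarrow> 'i set \<Rightarrow> ('i \<Rightarrow> 'v::real_vector) \<Rightarrow> bool" where
  "integral_coordinates L J X \<longleftrightarrow>
     (\<forall>B\<subseteq>J. independent_family X B \<longrightarrow>
        (\<forall>c. (\<Sum>i\<in>B. c i *\<^sub>R X i) \<in> L \<longrightarrow> (\<forall>i\<in>B. c i \<in> \<int>)))"

text \<open>Independence of the \<open>p_Y\<close> as functions on the whole space: this needs no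
  coordinates and allows evaluation at projected points.\<close>

definition independent_products :: "('i \<Rightarrow> 'v::real_inner) \<Rightarrow> 'i set set \<Rightarrow> bool" where
  "independent_products X F \<longleftrightarrow>
     (\<forall>c. (\<forall>t. (\<Sum>Y\<in>F. c Y * (\<Prod>i\<in>Y. complex_of_real (X i \<bullet> t))) = 0) \<longrightarrow> (\<forall>Y\<in>F. c Y = 0))"

lemma integral_coordinatesD:
  assumes "integral_coordinates L J X" "B \<subseteq> J" "independent_family X B"
    "(\<Sum>i\<in>B. c i *\<^sub>R X i) \<in> L" "i \<in> B"
  shows "c i \<in> \<int>"
  using assms unfolding integral_coordinates_def by blast

section \<open>Geometry of zonotopes\<close>

lemma convex_zonotope: "convex (zonotope J X)"
proof (rule convexI)
  fix x y and u v :: real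
  assume "x \<in> zonotope J X" "y \<in> zonotope J X" and uv: "0 \<le> u" "0 \<le> v" "u + v = 1"
  then obtain s t where s: "x = (\<Sum>i\<in>J. s i *\<^sub>R X i)" "\<forall>i\<in>J. s i \<in> {0..1}"
    and t: "y = (\<Sum>i\<in>J. t i *\<^sub>R X i)" "\<forall>i\<in>J. t i \<in> {0..1}"
    by (auto simp: zonotope_def)
  have "u *\<^sub>R x + v *\<^sub>R y = (\<Sum>i\<in>J. (u * s i + v * t i) *\<^sub>R X i)"
    by (simp add: s t scaleR_sum_right scaleR_add_left sum.distrib)
  moreover have "u * s i + v * t i \<in> {0..1}" if "i \<in> J" for i
    using convexD[OF convex_real_interval(5)[of 0 1], of "s i" "t i" u v] s(2) t(2) uv that by simp
  ultimately show "u *\<^sub>R x + v *\<^sub>R y \<in> zonotope J X"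
    unfolding zonotope_def by (intro CollectI exI[of _ "\<lambda>i. u * s i + v * t i"]) auto
qed

lemma zonotope_insertE:
  assumes "z \<in> zonotope (insert x J) X" "finite J" "x \<notin> J"
  obtains w s where "w \<in> zonotope J X" "0 \<le> s" "s \<le> 1" "z = s *\<^sub>R X x + w"
proof -
  obtain t where "z = (\<Sum>i\<in>insert x J. t i *\<^sub>R X i)" "\<forall>i\<in>insert x J. t i \<in> {0..1}"
    using assms(1) by (auto simp: zonotope_def)
  then show ?thesis
    using assms(2,3) by (intro that[of "\<Sum>i\<in>J. t i *\<^sub>R X i" "t x"]) (auto simp: zonotope_def)
qed

lemma zonotope_linear_image:
  assumes "linear h" "z \<in> zonotope J X"
  shows "h z \<in> zonotope J (h \<circ> X)"
  using assms by (force simp: zonotope_def linear_sum linear_scale)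

text \<open>Both points decompose along \<open>X x\<close>, and \<open>z\<close> lies between the two components in the smaller zonotope.\<close>

lemma zonotope_remove:
  assumes "finite J" "x \<notin> J" "k \<ge> 1"
    and "z \<in> zonotope (insert x J) X" "z + k *\<^sub>R X x \<in> zonotope (insert x J) X"
  shows "z \<in> zonotope J X"
proof -
  obtain v s where v: "v \<in> zonotope J X" "0 \<le> s" "s \<le> 1" "z = s *\<^sub>R X x + v"
    using zonotope_insertE[OF assms(4,1,2)] .
  obtain w r where w: "w \<in> zonotope J X" "0 \<le> r" "r \<le> 1" "z + k *\<^sub>R X x = r *\<^sub>R X x + w"
    using zonotope_insertE[OF assms(5,1,2)] .
  \<comment> \<open>\<open>w\<close> lies \<open>q\<close> steps ahead of \<open>z\<close> along
    \<open>X x\<close>, and \<open>v\<close> lies \<open>s\<close> steps behind;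
    \<open>q \<ge> 0\<close> because \<open>r \<le> 1 \<le> k\<close>. The weights
    \<open>q / (q + s)\<close> on \<open>v\<close> and \<open>s / (q + s)\<close> on
    \<open>w\<close> then give \<open>z\<close>.\<close>
  define q where "q = k - r"
  have q: "q \<ge> 0" and w': "w = z + q *\<^sub>R X x"
    using w assms(3) by (auto simp: q_def algebra_simps)
  have v': "v = z - s *\<^sub>R X x" using v by simp
  show ?thesis
  proof (cases "q + s = 0")
    case True
    then have "s = 0" using q v(2) by linarith
    then show ?thesis using v by simp
  next
    case False
    then have pos: "q + s > 0" using q v(2) by linarith
    have "(q / (q + s)) *\<^sub>R v + (s / (q + s)) *\<^sub>R w
        = (q / (q + s) + s / (q + s)) *\<^sub>R z + (s / (q + s) * q - q / (q + s) * s) *\<^sub>R X x"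
      unfolding v' w' by (simp add: algebra_simps)
    also have "\<dots> = z"
      using pos by (simp flip: add_divide_distrib)
    finally show ?thesis
      using convexD[OF convex_zonotope v(1) w(1), of "q / (q + s)" "s / (q + s)"] q v(2) pos
      by (simp flip: add_divide_distrib)
  qed
qed

text \<open>Off the hyperplane orthogonal to \<open>x\<close> the factor cancels. A point
  \<open>t\<close> of the hyperplane is the limit of the points \<open>t + e *\<^sub>R x\<close>
  with \<open>e \<noteq> 0\<close>, so continuity finishes.\<close>

lemma product_continuous_cancel:
  fixes q :: "'v::real_inner \<Rightarrow> complex"
  assumes "x \<noteq> 0" "continuous_on UNIV q" "\<And>t. complex_of_real (x \<bullet> t) * q t = 0"
  shows "q t = 0"
proof (cases "x \<bullet> t = 0")
  case False
  then show ?thesis using assms(3)[of t] by simp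
next
  case True
  have "isCont (\<lambda>e. q (t + e *\<^sub>R x)) 0"
    by (rule continuous_at_compose[of _ "\<lambda>e. t + e *\<^sub>R x" q, unfolded o_def])
      (use assms(2) in \<open>auto simp: continuous_on_eq_continuous_at intro!: continuous_intros\<close>)
  then have "((\<lambda>e. q (t + e *\<^sub>R x)) \<longlongrightarrow> q t) (at 0)"
    by (simp add: isCont_def)
  moreover have "q (t + e *\<^sub>R x) = 0" if "e \<noteq> 0" for e
    using assms(3)[of "t + e *\<^sub>R x"] True assms(1) that by (simp add: inner_add_right)
  then have "((\<lambda>e. q (t + e *\<^sub>R x)) \<longlongrightarrow> 0) (at (0::real))"
    by (intro tendsto_eventually) (auto simp: eventually_at_filter)
  ultimately show ?thesis
    using LIM_unique by blast
qed

section \<open>Contraction by orthogonal projection\<close>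

text \<open>Orthogonal projection onto the complement of \<open>x\<close>. It realises the quotient
  by the line of \<open>x\<close> inside the same space, so contraction stays within one
  type.\<close>

definition project_along :: "'v::real_inner \<Rightarrow> 'v \<Rightarrow> 'v" where
  "project_along x v = v - ((x \<bullet> v) / (x \<bullet> x)) *\<^sub>R x"

lemma linear_project_along: "linear (project_along x)"
  by (rule linearI) (simp_all add: project_along_def inner_add_right add_divide_distrib algebra_simps)

lemma project_along_self [simp]: "project_along x x = 0"
  by (cases "x = 0") (simp_all add: project_along_def)

lemma inner_project_along_self [simp]: "x \<bullet> project_along x v = 0"
  by (cases "x = 0") (simp_all add: project_along_def inner_diff_right)

text \<open>Self-adjointness: evaluating a product at a projected point amounts to projecting the
  family.\<close>

lemma inner_project_along: "v \<bullet> project_along x w = project_along x v \<bullet> w"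
  by (simp add: project_along_def inner_diff_right inner_diff_left inner_commute)

lemma project_along_eq_iff: "project_along x v = project_along x w \<longleftrightarrow> (\<exists>k. w = v + k *\<^sub>R x)"
proof
  assume "project_along x v = project_along x w"
  then show "\<exists>k. w = v + k *\<^sub>R x"
    by (intro exI[of _ "(x \<bullet> w) / (x \<bullet> x) - (x \<bullet> v) / (x \<bullet> x)"])
      (simp add: project_along_def algebra_simps)
next
  assume "\<exists>k. w = v + k *\<^sub>R x"
  then show "project_along x v = project_along x w"
    by (auto simp: linear_add[OF linear_project_along] linear_scale[OF linear_project_along])
qed

text \<open>A family independent after projection stays independent upstairs when \<open>x\<close>
  is added. A projected lattice point lifts to a lattice point with the same coordinates and one
  more at \<open>x\<close>, and these are integral.\<close>

lemma integral_coordinates_contract: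
  assumes L: "integral_coordinates L (insert x J) X" and J: "finite J" "x \<notin> J" and x: "X x \<noteq> 0"
  shows "integral_coordinates (project_along (X x) ` L) J (project_along (X x) \<circ> X)"
  unfolding integral_coordinates_def
proof (intro allI impI ballI)
  let ?p = "project_along (X x)"
  have psum: "?p (\<Sum>i\<in>A. c i *\<^sub>R X i) = (\<Sum>i\<in>A. c i *\<^sub>R (?p \<circ> X) i)" for A c
    by (simp add: linear_sum[OF linear_project_along] linear_scale[OF linear_project_along])
  fix B c i
  assume B: "B \<subseteq> J" and ind: "independent_family (?p \<circ> X) B"
    and "(\<Sum>i\<in>B. c i *\<^sub>R (?p \<circ> X) i) \<in> ?p ` L" and i: "i \<in> B"
  then obtain z where z: "z \<in> L" "?p (\<Sum>i\<in>B. c i *\<^sub>R X i) = ?p z"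
    by (auto simp: psum)
  then obtain k where k: "z = (\<Sum>i\<in>B. c i *\<^sub>R X i) + k *\<^sub>R X x"
    by (auto simp: project_along_eq_iff)
  have xB: "x \<notin> B" "finite B" using B J finite_subset by auto
  have "independent_family X (insert x B)"
    unfolding independent_family_def
  proof (intro allI impI)
    fix a assume a: "(\<Sum>i\<in>insert x B. a i *\<^sub>R X i) = 0"
    then have "(\<Sum>i\<in>insert x B. a i *\<^sub>R (?p \<circ> X) i) = 0"
      using psum[of a "insert x B"] by (simp add: linear_0[OF linear_project_along])
    then have aB: "\<forall>i\<in>B. a i = 0"
      using ind xB by (auto simp: independent_family_def)
    then have "a x *\<^sub>R X x = 0" using a xB by simp
    then show "\<forall>i\<in>insert x B. a i = 0" using aB x by auto
  qed
  moreover have "(\<Sum>i\<in>insert x B. (c(x := k)) i *\<^sub>R X i) = z"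
  proof -
    have "(\<Sum>i\<in>B. (c(x := k)) i *\<^sub>R X i) = (\<Sum>i\<in>B. c i *\<^sub>R X i)"
      using xB by (intro sum.cong) auto
    then show ?thesis using xB k by simp
  qed
  moreover have "insert x B \<subseteq> insert x J" using B by blast
  ultimately have "(c(x := k)) i \<in> \<int>"
    using integral_coordinatesD[OF L, of "insert x B" "c(x := k)" i] z(1) i by simp
  then show "c i \<in> \<int>" using i xB by (auto split: if_splits)
qed

text \<open>A relation has the form \<open>p_x * q + r = 0\<close>, with \<open>q\<close> from
  \<open>F1\<close> and \<open>r\<close> from \<open>F2\<close>. On the hyperplane orthogonal to
  \<open>X x\<close> only \<open>r\<close> remains, which kills the coefficients on
  \<open>F2\<close>; cancelling \<open>p_x\<close> then leaves \<open>q = 0\<close>, a relation over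
  \<open>F1\<close>.\<close>

lemma independent_products_insert:
  assumes J: "finite J" "x \<notin> J" and x: "X x \<noteq> 0"
    and F1: "F1 \<subseteq> Pow J" "independent_products X F1"
    and F2: "F2 \<subseteq> Pow J" "independent_products (project_along (X x) \<circ> X) F2"
  shows "independent_products X (insert x ` F1 \<union> F2)"
  unfolding independent_products_def
proof (rule allI, rule impI)
  let ?p = "project_along (X x)"
  let ?P = "\<lambda>X Y t. \<Prod>i\<in>Y. complex_of_real (X i \<bullet> t)"
  have fin: "finite F1" "finite F2" 
    using F1(1) F2(1) J(1) by (auto intro: finite_subset[of _ "Pow J"])
  have disj: "insert x ` F1 \<inter> F2 = {}" using F2(1) J(2) by auto
  have inj: "inj_on (insert x) F1"
    using inj_on_insert_Pow[OF J(2)] F1(1) by (rule inj_on_subset)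
  fix c
  assume c: "\<forall>t. (\<Sum>Y\<in>insert x ` F1 \<union> F2. c Y * ?P X Y t) = 0"
  define q where "q t = (\<Sum>Y\<in>F1. c (insert x Y) * ?P X Y t)" for t
  have split: "complex_of_real (X x \<bullet> t) * q t + (\<Sum>Y\<in>F2. c Y * ?P X Y t) = 0" for t
  proof -
    have "(\<Sum>Y\<in>insert x ` F1. c Y * ?P X Y t) = (\<Sum>Y\<in>F1. c (insert x Y) * ?P X (insert x Y) t)"
      using inj by (simp add: sum.reindex)
    also have "\<dots> = (\<Sum>Y\<in>F1. complex_of_real (X x \<bullet> t) * (c (insert x Y) * ?P X Y t))"
    proof (intro sum.cong refl)
      fix Y assume "Y \<in> F1"
      then have "finite Y" "x \<notin> Y" using F1(1) J finite_subset by auto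
      then show "c (insert x Y) * ?P X (insert x Y) t = complex_of_real (X x \<bullet> t) * (c (insert x Y) * ?P X Y t)"
        by simp
    qed
    finally show ?thesis
      using spec[OF c, of t] fin disj by (simp add: sum.union_disjoint q_def sum_distrib_left)
  qed
  have "(\<Sum>Y\<in>F2. c Y * ?P (?p \<circ> X) Y t) = 0" for t
    using split[of "?p t"] by (simp add: inner_project_along)
  then have c2: "\<forall>Y\<in>F2. c Y = 0"
    using F2(2) unfolding independent_products_def by blast
  have "q t = 0" for t
  proof (rule product_continuous_cancel[OF x])
    show "continuous_on UNIV q"
      unfolding q_def by (intro continuous_intros)
    show "complex_of_real (X x \<bullet> t) * q t = 0" for t
      using split[of t] c2 by simp
  qed
  then have "\<forall>Y\<in>F1. c (insert x Y) = 0"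
    using F1(2)[unfolded independent_products_def, rule_format, of "\<lambda>Y. c (insert x Y)"]
    unfolding q_def by blast
  then show "\<forall>Y\<in>insert x ` F1 \<union> F2. c Y = 0"
    using c2 by auto
qed

text \<open>A general \<open>L\<close> closed under differences replaces the integer points because
  contraction projects the lattice. Finite subsets \<open>S\<close> are counted so that finiteness
  of the set of lattice points is not presupposed.\<close>

lemma card_zonotope_points_le_independent_products:
  fixes X :: "'i \<Rightarrow> real ^ 'n"
  assumes "finite J" "integral_coordinates L J X" "\<And>v w. v \<in> L \<Longrightarrow> w \<in> L \<Longrightarrow> v - w \<in> L"
    and "finite S" "S \<subseteq> zonotope J X \<inter> L"
  shows "\<exists>F\<subseteq>Pow J. card S \<le> card F \<and> independent_products X F"
  using assms
proof (induction J arbitrary: X L S rule: finite_induct)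
  case empty
  then have "S \<subseteq> {0}" by (auto simp: zonotope_def)
  then have "card S \<le> 1" using card_mono[of "{0}" S] by simp
  then show ?case
    by (intro exI[of _ "{{}}"]) (simp add: independent_products_def)
next
  case (insert x J)
  have del: "integral_coordinates L J X"
    using insert.prems(1) unfolding integral_coordinates_def by blast
  show ?case
  proof (cases "X x = 0")
    \<comment> \<open>A vector parallel to a contracted one projects to 0. It leaves the zonotope
      unchanged, so its index is dropped.\<close>
    case True
    have "S \<subseteq> zonotope J X \<inter> L"
    proof
      fix z assume "z \<in> S"
      then have "z \<in> zonotope (insert x J) X" "z \<in> L" using insert.prems(4) by auto
      then show "z \<in> zonotope J X \<inter> L"
        using insert.hyps True by (auto elim!: zonotope_insertE)
    qed
    then show ?thesis
      using insert.IH[OF del insert.prems(2,3)] by blast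
  next
    case False
    let ?p = "project_along (X x)"
    \<comment> \<open>These are the points of \<open>S\<close> that are not last on their line in
      the direction \<open>X x\<close>.\<close>
    define S1 where "S1 = {z\<in>S. \<exists>k>0. z + k *\<^sub>R X x \<in> S}"
    have "S1 \<subseteq> zonotope J X \<inter> L"
    proof
      fix z assume "z \<in> S1"
      then obtain k where k: "k > 0" "z \<in> S" "z + k *\<^sub>R X x \<in> S"
        by (auto simp: S1_def)
      \<comment> \<open>\<open>k\<close> is the coordinate of a lattice point with respect to
        \<open>X x\<close> alone, hence an integer. Being positive, it is at least 1, as
        \<open>zonotope_remove\<close> requires.\<close>
      then have "k *\<^sub>R X x \<in> L"
        using insert.prems(2)[of "z + k *\<^sub>R X x" z] insert.prems(4) by auto
      moreover have "independent_family X {x}"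
        using False by (simp add: independent_family_def)
      ultimately have "k \<in> \<int>"
        using integral_coordinatesD[OF insert.prems(1), of "{x}" "\<lambda>_. k" x] by simp
      then have "k \<ge> 1" using k(1) by (auto elim!: Ints_cases)
      then have "z \<in> zonotope J X"
        using insert.hyps k insert.prems(4) by (intro zonotope_remove[of J x k z X]) auto
      then show "z \<in> zonotope J X \<inter> L" using k insert.prems(4) by auto
    qed
    moreover have S1: "S1 \<subseteq> S" "finite S1" using insert.prems(3) by (auto simp: S1_def)
    ultimately obtain F1 where F1: "F1 \<subseteq> Pow J" "card S1 \<le> card F1" "independent_products X F1"
      using insert.IH[OF del insert.prems(2), of S1] by blast
    \<comment> \<open>Of two distinct points on one line, the one further back lies in
      \<open>S1\<close>.\<close>
    have inj: "inj_on ?p (S - S1)"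
    proof (rule inj_onI)
      fix v w assume vw: "v \<in> S - S1" "w \<in> S - S1" "?p v = ?p w"
      then obtain k where k: "w = v + k *\<^sub>R X x" by (auto simp: project_along_eq_iff)
      have "\<not> k > 0" using vw k by (auto simp: S1_def)
      moreover have "\<not> - k > 0"
      proof
        assume "- k > 0"
        moreover have "w + (- k) *\<^sub>R X x = v" using k by simp
        ultimately have "\<exists>k>0. w + k *\<^sub>R X x \<in> S" using vw(1) by blast
        then show False using vw(2) by (auto simp: S1_def)
      qed
      ultimately show "v = w" using k by simp
    qed
    have sub: "?p ` (S - S1) \<subseteq> zonotope J (?p \<circ> X) \<inter> ?p ` L"
    proof
      fix u assume "u \<in> ?p ` (S - S1)"
      then obtain z where z: "u = ?p z" "z \<in> L" "z \<in> zonotope (insert x J) X"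
        using insert.prems(4) by auto
      obtain w s where w: "w \<in> zonotope J X" "z = s *\<^sub>R X x + w"
        using zonotope_insertE[OF z(3) insert.hyps] .
      then have "u = ?p w"
        by (simp add: z(1) linear_add[OF linear_project_along] linear_scale[OF linear_project_along])
      then have "u \<in> zonotope J (?p \<circ> X)"
        using zonotope_linear_image[OF linear_project_along w(1)] by simp
      then show "u \<in> zonotope J (?p \<circ> X) \<inter> ?p ` L"
        using z(1,2) by blast
    qed
    have diff: "v - w \<in> ?p ` L" if "v \<in> ?p ` L" "w \<in> ?p ` L" for v w
      using that insert.prems(2) by (auto simp flip: linear_diff[OF linear_project_along])
    have "finite (?p ` (S - S1))" using insert.prems(3) by simp
    then obtain F2 where F2: "F2 \<subseteq> Pow J" "card (?p ` (S - S1)) \<le> card F2"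
        "independent_products (?p \<circ> X) F2"
      using insert.IH[OF integral_coordinates_contract[OF insert.prems(1) insert.hyps False] diff _ sub]
      by blast
    have fin: "finite F1" "finite F2"
      using F1(1) F2(1) insert.hyps(1) by (auto intro: finite_subset[of _ "Pow J"])
    have "card S = card S1 + card (S - S1)"
      using S1 insert.prems(3) card_mono[of S S1] by (simp add: card_Diff_subset)
    also have "\<dots> \<le> card F1 + card F2"
      using F1(2) F2(2) inj by (simp add: card_image)
    also have "card F1 = card (insert x ` F1)"
      using inj_on_subset[OF inj_on_insert_Pow[OF insert.hyps(2)] F1(1)] by (simp add: card_image)
    also have "card (insert x ` F1) + card F2 = card (insert x ` F1 \<union> F2)"
      using fin F2(1) insert.hyps(2) by (intro card_Un_disjoint[symmetric]) auto
    finally show ?thesis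
      using F1 F2 insert.hyps False
      by (intro exI[of _ "insert x ` F1 \<union> F2"] conjI independent_products_insert) auto
  qed
qed

section \<open>Integrality from unimodularity\<close>

lemma Ints_det:
  fixes A :: "real ^ 'n ^ 'n"
  assumes "\<And>i j. A $ i $ j \<in> \<int>"
  shows "det A \<in> \<int>"
  unfolding det_def using assms by (intro Ints_sum Ints_mult Ints_prod) auto

text \<open>\<open>B\<close> extends to a basis within \<open>X\<close>, with determinant 1 or -1.
  Cramer's rule then gives each coordinate as an integer determinant divided by 1 or -1.\<close>

lemma unimodular_integral_coordinates:
  fixes X :: "'i \<Rightarrow> real ^ 'n"
  assumes "finite I" "span (X ` I) = UNIV" "unimodular I X"
  shows "integral_coordinates integer_points I X"
  unfolding integral_coordinates_def
proof (intro allI impI ballI)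
  fix B c k
  assume B: "B \<subseteq> I" and ind: "independent_family X B"
    and z: "(\<Sum>i\<in>B. c i *\<^sub>R X i) \<in> integer_points" and k: "k \<in> B"
  have finB: "finite B" using B assms(1) by (rule finite_subset)
  have inj: "inj_on X B"
  proof (rule inj_onI, rule ccontr)
    fix i j assume ij: "i \<in> B" "j \<in> B" "X i = X j" "i \<noteq> j"
    let ?a = "\<lambda>l. if l = i then 1 else if l = j then - 1 else (0::real)"
    have "(\<Sum>l\<in>B. ?a l *\<^sub>R X l) = (\<Sum>l\<in>{i, j}. ?a l *\<^sub>R X l)"
      using ij finB by (intro sum.mono_neutral_right) auto
    also have "\<dots> = 0" using ij by simp
    finally have "\<forall>l\<in>B. ?a l = 0"
      using ind[unfolded independent_family_def, rule_format, of ?a] by blast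
    then have "?a i = 0" using ij(1) by blast
    then show False by simp
  qed
  have "independent (X ` B)"
  proof (rule independent_if_scalars_zero)
    fix f v assume "(\<Sum>v\<in>X ` B. f v *\<^sub>R v) = 0" "v \<in> X ` B"
    then show "f v = 0"
      using ind[unfolded independent_family_def, rule_format, of "f \<circ> X"] inj
      by (auto simp: sum.reindex)
  qed (use finB in simp)
  then obtain C where C: "X ` B \<subseteq> C" "C \<subseteq> X ` I" "independent C" "X ` I \<subseteq> span C"
    using maximal_independent_subset_extend[of "X ` B" "X ` I"] B by blast
  have "C - X ` B \<subseteq> X ` I" using C(2) by auto
  \<comment> \<open>\<open>D\<close> picks one index for each added vector, so that \<open>X\<close>
    is injective on \<open>B \<union> D\<close>.\<close>
  then obtain D where D: "D \<subseteq> I" "inj_on X D" "C - X ` B = X ` D"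
    unfolding subset_image_inj by (elim exE conjE)
  let ?A = "B \<union> D"
  have im: "X ` ?A = C" using D C(1) by auto
  have injA: "inj_on X ?A"
    using inj D by (auto simp: inj_on_Un)
  have spanC: "span C = UNIV"
    using span_minimal[OF C(4) subspace_span] assms(2) by auto
  have basis: "basis_family X ?A"
    unfolding basis_family_def im using injA C(3) spanC by simp
  have "card C = CARD('n)"
    using C(3) spanC dim_eq_card[of C UNIV] by simp
  then have cardA: "card ?A = CARD('n)" using card_image[OF injA] im by simp
  have finA: "finite ?A" using finB finite_subset[OF D(1) assms(1)] by simp
  obtain e where e: "bij_betw e (UNIV :: 'n set) ?A"
    using finite_same_card_bij[of "UNIV :: 'n set" ?A] finA cardA by auto
  let ?M = "(\<chi> i j. X (e j) $ i) :: real ^ 'n ^ 'n"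
  have detM: "det ?M \<in> {1, -1}"
    using assms(3)[unfolded unimodular_def, THEN conjunct2, rule_format, of ?A e] basis e B D(1) by simp
  \<comment> \<open>Padding with 0 on the added indices turns the given combination into
    \<open>?M *v x\<close>.\<close>
  define a where "a i = (if i \<in> B then c i else 0)" for i
  define x :: "real ^ 'n" where "x = (\<chi> j. a (e j))"
  have "?M *v x = (\<Sum>j\<in>UNIV. a (e j) *\<^sub>R X (e j))"
    by (simp add: vec_eq_iff matrix_vector_mult_def x_def mult_ac)
  also have "\<dots> = (\<Sum>i\<in>?A. a i *\<^sub>R X i)"
    using sum.reindex_bij_betw[OF e, of "\<lambda>i. a i *\<^sub>R X i"] by simp
  also have "\<dots> = (\<Sum>i\<in>B. a i *\<^sub>R X i)"
    using finA by (intro sum.mono_neutral_right) (auto simp: a_def)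
  also have "\<dots> = (\<Sum>i\<in>B. c i *\<^sub>R X i)"
    by (intro sum.cong) (auto simp: a_def)
  finally have Mx: "?M *v x \<in> integer_points" using z by simp
  obtain j where j: "e j = k" using e k by (force simp: bij_betw_def)
  have "X (e l) $ i \<in> \<int>" for i l
  proof -
    have "e l \<in> I" using e B D(1) by (auto simp: bij_betw_def)
    then show ?thesis using assms(3) by (auto simp: unimodular_def integer_points_def)
  qed
  then have "det ((\<chi> i l. if l = j then (?M *v x) $ i else ?M $ i $ l) :: real ^ 'n ^ 'n) \<in> \<int>"
    using Mx by (intro Ints_det) (auto simp: integer_points_def)
  then have "x $ j * det ?M \<in> \<int>"
    unfolding cramer_lemma .
  then have "x $ j \<in> \<int>"
    using detM by (auto simp: minus_in_Ints_iff)
  then show "c k \<in> \<int>"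
    using k by (simp add: x_def j a_def)
qed

subsection \<open>Surjectivity\<close>

lemma sum_fun_apply: "(\<Sum>a\<in>A. f a) x = (\<Sum>a\<in>A. f a x)"
  by (induction A rule: infinite_finite_induct) simp_all

interpretation complex_fun: vector_space "\<lambda>(a::complex) (f :: 'b \<Rightarrow> complex) x. a * f x"
  by unfold_locales (auto simp: fun_eq_iff algebra_simps)

text \<open>The restrictions to \<open>Z\<close> are independent in a space spanned by the
  indicators of the points of \<open>Z\<close>. There are at least \<open>card Z\<close> of them, so
  they span it.\<close>

lemma independent_functions_interpolate:
  fixes g :: "'a \<Rightarrow> 'b \<Rightarrow> complex"
  assumes "finite Z" "finite F" "card Z \<le> card F"
    and ind: "\<And>c. (\<And>z. z \<in> Z \<Longrightarrow> (\<Sum>Y\<in>F. c Y * g Y z) = 0) \<Longrightarrow> \<forall>Y\<in>F. c Y = 0"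
  shows "\<exists>c. \<forall>z\<in>Z. (\<Sum>Y\<in>F. c Y * g Y z) = h z"
proof -
  define r where "r f = (\<lambda>z. if z \<in> Z then f z else 0 :: complex)" for f
  define G where "G Y = r (g Y)" for Y
  define U where "U = (\<lambda>w z. if z = w then 1 else 0 :: complex) ` Z"
  have U: "finite U" "card U \<le> card Z"
    using assms(1) by (auto simp: U_def card_image_le)
  have r_span: "r f \<in> complex_fun.span U" for f
  proof -
    have "r f = (\<Sum>w\<in>Z. (\<lambda>z. f w * (if z = w then 1 else 0)))"
      using assms(1) by (auto simp: r_def fun_eq_iff sum_fun_apply if_distrib cong: if_cong)
    also have "\<dots> \<in> complex_fun.span U"
      by (intro complex_fun.span_sum complex_fun.span_scale complex_fun.span_base) (auto simp: U_def)
    finally show ?thesis .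
  qed
  have combination: "(\<Sum>Y\<in>F. (\<lambda>z. c Y * G Y z)) z = (\<Sum>Y\<in>F. c Y * g Y z)" if "z \<in> Z" for c z
    using that by (simp add: G_def r_def sum_fun_apply)
  \<comment> \<open>Independence below concerns the image set. Two indices with the same restriction
    would give a relation with coefficients 1 and -1.\<close>
  have inj: "inj_on G F"
  proof (rule inj_onI, rule ccontr)
    fix A B assume AB: "A \<in> F" "B \<in> F" "G A = G B" "A \<noteq> B"
    let ?c = "\<lambda>Y. if Y = A then 1 else if Y = B then - 1 else (0::complex)"
    have "(\<Sum>Y\<in>F. ?c Y * g Y z) = 0" if "z \<in> Z" for z
    proof -
      have "(\<Sum>Y\<in>F. ?c Y * g Y z) = (\<Sum>Y\<in>{A, B}. ?c Y * g Y z)"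
        using AB assms(2) by (intro sum.mono_neutral_right) auto
      also have "\<dots> = G A z - G B z" using AB(4) that by (simp add: G_def r_def)
      finally show ?thesis using AB(3) by simp
    qed
    from bspec[OF ind[OF this] AB(1)] show False by simp
  qed
  have indG: "complex_fun.independent (G ` F)"
  proof (rule complex_fun.independent_if_scalars_zero)
    fix a v assume a: "(\<Sum>v\<in>G ` F. (\<lambda>z. a v * v z)) = 0" and v: "v \<in> G ` F"
    have "(\<Sum>Y\<in>F. a (G Y) * g Y z) = 0" if "z \<in> Z" for z
      using combination[OF that, of "a \<circ> G"] a inj by (simp add: sum.reindex o_def)
    from ind[OF this] v show "a v = 0" by auto
  qed (use assms(2) in simp)
  have "r h \<in> complex_fun.span (G ` F)"
  proof (rule ccontr)
    assume notin: "r h \<notin> complex_fun.span (G ` F)"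
    then have new: "r h \<notin> G ` F" by (rule contrapos_nn) (rule complex_fun.span_base)
    \<comment> \<open>Adding \<open>r h\<close> would give more than \<open>card Z\<close>
      independent functions in the span of \<open>U\<close>.\<close>
    have "complex_fun.independent (insert (r h) (G ` F))"
      using notin indG by (rule complex_fun.independent_insertI)
    moreover have "insert (r h) (G ` F) \<subseteq> complex_fun.span U"
      using r_span by (auto simp: G_def)
    ultimately have "card (insert (r h) (G ` F)) \<le> card U"
      using complex_fun.independent_span_bound[OF U(1)] by blast
    then show False
      using new assms(2,3) U(2) inj by (simp add: card_image)
  qed
  then obtain a where "r h = (\<Sum>v\<in>G ` F. (\<lambda>z. a v * v z))"
    using complex_fun.span_finite[of "G ` F"] assms(2) by auto
  then have rh: "r h = (\<Sum>Y\<in>F. (\<lambda>z. (a \<circ> G) Y * G Y z))"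
    using inj by (simp add: sum.reindex)
  have "(\<Sum>Y\<in>F. (a \<circ> G) Y * g Y z) = h z" if "z \<in> Z" for z
    using combination[OF that, of "a \<circ> G"] fun_cong[OF rh, of z] that by (simp add: r_def)
  then show ?thesis by blast
qed

text \<open>The coefficients are 0 and 1, and the vectors are integral. Hence vanishing on
  \<open>Z_plus\<close> covers the points that the injectivity argument uses.\<close>

lemma subset_sum_in_Z_plus:
  assumes "finite I" "unimodular I X" "T \<subseteq> I"
  shows "sum X T \<in> Z_plus I X"
proof -
  have "sum X T = (\<Sum>i\<in>I. (if i \<in> T then 1 else 0) *\<^sub>R X i)"
    using assms(1,3) by (simp add: if_distrib[of "\<lambda>a. a *\<^sub>R _"] sum.If_cases Int_absorb1 cong: if_cong)
  then have "sum X T \<in> zonotope I X"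
    unfolding zonotope_def by (intro CollectI exI[of _ "\<lambda>i. if i \<in> T then 1 else 0"]) auto
  moreover have "sum X T $ j \<in> \<int>" for j
    using assms(2,3) by (auto simp: unimodular_def integer_points_def intro!: Ints_sum)
  ultimately show ?thesis by (simp add: Z_plus_def integer_points_def)
qed

lemma cpoly_eval_combination:
  "cpoly_eval (\<Sum>Y\<in>F. cpoly_const (c Y) * prod_poly X Y) (complex_vec t) =
     (\<Sum>Y\<in>F. c Y * (\<Prod>i\<in>Y. complex_of_real (X i \<bullet> t)))"
  by (simp add: cpoly_eval_sum cpoly_eval_mult cpoly_eval_const cpoly_eval_prod_poly)

theorem proposition1p7:
  fixes I :: "'i set" and X :: "'i \<Rightarrow> real ^ 'n"
  assumes "finite I"
    and "\<forall>i\<in>I. X i \<noteq> 0"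
    and "span (X ` I) = UNIV"
    and "unimodular I X"
  shows "bij_betw (restrict_poly (Z_plus I X)) (P_plus I X) (Z_plus I X \<rightarrow>\<^sub>E (UNIV :: complex set))"
proof -
  let ?Z = "Z_plus I X"
  have vanish: "f = 0" if "f \<in> P_plus I X" "\<And>z. z \<in> ?Z \<Longrightarrow> cpoly_eval f (complex_vec z) = 0" for f
    using that subset_sum_in_Z_plus[OF assms(1,4)]
    by (intro P_plus_eq_0_if_vanishes_on_subset_sums[OF assms(1)]) auto
  have diff: "v - w \<in> integer_points" if "v \<in> integer_points" "w \<in> integer_points" for v w :: "real ^ 'n"
    using that by (auto simp: integer_points_def)
  have family: "\<exists>F\<subseteq>Pow I. card S \<le> card F \<and> independent_products X F" if "finite S" "S \<subseteq> ?Z" for S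
    using card_zonotope_points_le_independent_products[OF assms(1)
        unimodular_integral_coordinates[OF assms(1,3,4)] diff that(1)] that(2)
    by (auto simp: Z_plus_def)
  \<comment> \<open>An infinite set would contain more points than \<open>I\<close> has subsets,
    while the matching \<open>F\<close> is a part of \<open>Pow I\<close>.\<close>
  have finZ: "finite ?Z"
  proof (rule ccontr)
    assume "infinite ?Z"
    then obtain S where S: "finite S" "S \<subseteq> ?Z" "card S = Suc (card (Pow I))"
      using infinite_arbitrarily_large[of ?Z] by blast
    obtain F where "F \<subseteq> Pow I" "card S \<le> card F"
      using family[OF S(1,2)] by auto
    moreover have "card F \<le> card (Pow I)"
      using \<open>F \<subseteq> Pow I\<close> assms(1) by (intro card_mono) auto
    ultimately show False using S(3) by simp
  qed
  obtain F where F: "F \<subseteq> Pow I" "card ?Z \<le> card F" "independent_products X F"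
    using family[OF finZ order_refl] by auto
  have finF: "finite F" using F(1) assms(1) by (auto intro: finite_subset[of _ "Pow I"])
  have comb: "(\<Sum>Y\<in>F. cpoly_const (c Y) * prod_poly X Y) \<in> P_plus I X" for c
    unfolding P_plus_def using F(1)
    by (intro cpoly.span_sum cpoly.span_scale cpoly.span_base) auto
  have onto: "\<exists>f\<in>P_plus I X. \<forall>z\<in>?Z. cpoly_eval f (complex_vec z) = h z" for h
  proof -
    have "\<exists>c. \<forall>z\<in>?Z. (\<Sum>Y\<in>F. c Y * (\<Prod>i\<in>Y. complex_of_real (X i \<bullet> z))) = h z"
    proof (rule independent_functions_interpolate[OF finZ finF F(2)])
      \<comment> \<open>Injectivity upgrades vanishing on \<open>Z_plus\<close> to vanishing as a
        polynomial, hence at every \<open>t\<close>, where independence of the products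
        applies.\<close>
      fix c assume "\<And>z. z \<in> ?Z \<Longrightarrow> (\<Sum>Y\<in>F. c Y * (\<Prod>i\<in>Y. complex_of_real (X i \<bullet> z))) = 0"
      then have "(\<Sum>Y\<in>F. cpoly_const (c Y) * prod_poly X Y) = 0"
        by (intro vanish comb) (simp add: cpoly_eval_combination)
      then have "(\<Sum>Y\<in>F. c Y * (\<Prod>i\<in>Y. complex_of_real (X i \<bullet> t))) = 0" for t
        unfolding cpoly_eval_combination[symmetric] by (simp add: cpoly_eval_def)
      then show "\<forall>Y\<in>F. c Y = 0"
        using F(3) unfolding independent_products_def by blast
    qed
    then show ?thesis
      using comb unfolding cpoly_eval_combination[symmetric] by blast
  qed
  have restrict: "restrict_poly ?Z f = (\<lambda>z\<in>?Z. cpoly_eval f (complex_vec z))" for f :: "'n cpoly"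
    by (simp add: restrict_poly_def complex_vec_def)
  show ?thesis
    unfolding bij_betw_def
  proof
    show "inj_on (restrict_poly ?Z) (P_plus I X)"
    proof (rule inj_onI)
      fix f g assume fg: "f \<in> P_plus I X" "g \<in> P_plus I X" "restrict_poly ?Z f = restrict_poly ?Z g"
      have "f - g = 0"
      proof (rule vanish)
        show "f - g \<in> P_plus I X"
          using fg unfolding P_plus_def by (intro cpoly.span_diff)
        fix z assume "z \<in> ?Z"
        then have "cpoly_eval f (complex_vec z) = cpoly_eval g (complex_vec z)"
          using fun_cong[OF fg(3), of z] by (simp add: restrict)
        then show "cpoly_eval (f - g) (complex_vec z) = 0"
          using cpoly_eval_add[of "f - g" g "complex_vec z"] by simp
      qed
      then show "f = g" by simp
    qed
    show "restrict_poly ?Z ` P_plus I X = ?Z \<rightarrow>\<^sub>E UNIV"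
    proof
      show "restrict_poly ?Z ` P_plus I X \<subseteq> ?Z \<rightarrow>\<^sub>E UNIV"
        by (auto simp: restrict)
      show "?Z \<rightarrow>\<^sub>E UNIV \<subseteq> restrict_poly ?Z ` P_plus I X"
      proof
        fix h :: "real ^ 'n \<Rightarrow> complex" assume h: "h \<in> ?Z \<rightarrow>\<^sub>E UNIV"
        obtain f where f: "f \<in> P_plus I X" "\<forall>z\<in>?Z. cpoly_eval f (complex_vec z) = h z"
          using onto[of h] by auto
        have "restrict_poly ?Z f = h"
          using f(2) h by (auto simp: restrict fun_eq_iff PiE_def extensional_def)
        then show "h \<in> restrict_poly ?Z ` P_plus I X"
          using f(1) by blast
      qed
    qed
  qed
qed

end
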